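(* Let $\mathbb{R}_+$ denote the positive reals and define $$\mathfrak{R}_1=\{(a,b,c)\in\mathbb{R}_+^3:\ c\ge a+b-1,\ (1+a+b-ab)c\ge 2ab,\ (c-a)(c-b)\ge0\},$$ $$\mathfrak{R}_2=\{(a,b,c)\in\mathbb{R}_+^3:\ c\ge a+b-1,\ (c-a)(c-b)\le0\}.$$ Let $p,q\in(1,\infty)$. For $s\in\mathbb{R}$ let $w_j(s)$ denote the Maclaurin coefficients of $\ln\left[(1-x)^sF(a,b;c;x)\right]=\sum_{j=1}^\infty w_j(s)x^j$, and for $n\ge1$ define on $(0,1)$ $$\mathcal{Q}_{s,n}(x)=\frac{1}{x^{1/q}-x}\ln\left[\frac{(1-x)^sF(a,b;c;x)}{(1-x^{1/q})^sF(a,b;c;x^{1/q})}\right]-\sum_{j=1}^nw_j(s)\frac{x^j-x^{j/q}}{x^{1/q}-x}.$$ - For $(a,b,c)\in\mathfrak{R}_1$: $\mathcal{Q}_{s,n}(x)<0$ for all $x\in(0,1)$ if $s\le\max\{0,a+b-c\}$, and $\mathcal{Q}_{s,n}(x)>0$ for all $x\in(0,1)$ if $s\ge\frac{ab}{c}$. Consequently, the double inequality $$\left(\frac{1-r^{p/q}}{1-r^p}\right)^{\frac{ab}{c}}\exp\left[\frac{ab(c-a)(c-b)(r^{2p/q}-r^{2p})}{2c^2(c+1)}\right]<\frac{F(a,b;c;r^p)}{F(a,b;c;r^{p/q})}<\left(\frac{1-r^{p/q}}{1-r^p}\right)^{s_0}\exp\left[\left(s_0-\frac{ab}{c}\right)(r^{p/q}-r^p)\right]$$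 holds for all $r\in(0,1)$, where $s_0=\max\{0,a+b-c\}$. - For $(a,b,c)\in\mathfrak{R}_2$: $\mathcal{Q}_{s,n}(x)<0$ for all $x\in(0,1)$ if $s\le\frac{ab}{c}$, and $\mathcal{Q}_{s,n}(x)>0$ for all $x\in(0,1)$ if $s\ge a+b-c$. Consequently, the double inequality $$\left(\frac{1-r^{p/q}}{1-r^p}\right)^{a+b-c}\exp\left[\frac{(a-c)(c-b)(r^{p/q}-r^p)}{c}\right]<\frac{F(a,b;c;r^p)}{F(a,b;c;r^{p/q})}<\left(\frac{1-r^{p/q}}{1-r^p}\right)^{\frac{ab}{c}}\exp\left[-\frac{ab(a-c)(c-b)(r^{2p/q}-r^{2p})}{2c^2(c+1)}\right]$$ holds for all $r\in(0,1)$.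
   Context: $F(a,b;c;x)=\sum_{n=0}^\infty\frac{(a)_n(b)_n}{(c)_n}\frac{x^n}{n!}$ is the Gaussian hypergeometric function, with $(a)_0=1$ and $(a)_n=a(a+1)\cdots(a+n-1)$ for $n\ge1$. Here $n$ is a positive integer.
   Formalization: If c=a or c=b, then F(a,b;c;x)=(1-x)^{-ab/c}, so Q_{s,n} vanishes at s=ab/c and both double inequalities are equalities; in exactly these cases the strict inequalities are replaced by non-strict ones. *)

theory Defs
  imports "HOL-Analysis.Analysis"
begin

definition gauss_hyp :: "real \<Rightarrow> real \<Rightarrow> real \<Rightarrow> real \<Rightarrow> real" where
  "gauss_hyp a b c x =
     (\<Sum>n. pochhammer a n * pochhammer b n / pochhammer c n * (x ^ n / fact n))"

definition region1 :: "(real \<times> real \<times> real) set" where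
  "region1 = {(a, b, c). a > 0 \<and> b > 0 \<and> c > 0 \<and>
     c \<ge> a + b - 1 \<and> (1 + a + b - a * b) * c \<ge> 2 * a * b \<and> (c - a) * (c - b) \<ge> 0}"

definition region2 :: "(real \<times> real \<times> real) set" where
  "region2 = {(a, b, c). a > 0 \<and> b > 0 \<and> c > 0 \<and>
     c \<ge> a + b - 1 \<and> (c - a) * (c - b) \<le> 0}"

definition maclaurin_coeff :: "(real \<Rightarrow> real) \<Rightarrow> nat \<Rightarrow> real" where
  "maclaurin_coeff f j = (deriv ^^ j) f 0 / fact j"

definition log_coeff :: "real \<Rightarrow> real \<Rightarrow> real \<Rightarrow> real \<Rightarrow> nat \<Rightarrow> real" where
  "log_coeff a b c s j =
     maclaurin_coeff (\<lambda>x. ln ((1 - x) powr s * gauss_hyp a b c x)) j"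

definition Q_fun ::
  "real \<Rightarrow> real \<Rightarrow> real \<Rightarrow> real \<Rightarrow> real \<Rightarrow> nat \<Rightarrow> real \<Rightarrow> real" where
  "Q_fun a b c q s n x =
     1 / (x powr (1 / q) - x) *
       ln (((1 - x) powr s * gauss_hyp a b c x) /
           ((1 - x powr (1 / q)) powr s * gauss_hyp a b c (x powr (1 / q))))
     - (\<Sum>j = 1..n. log_coeff a b c s j *
           ((x ^ j - x powr (real j / q)) / (x powr (1 / q) - x)))"

text \<open>
  For \<open>c = a\<close> (and symmetrically \<open>c = b\<close>) the series is binomial, and at
  \<open>s = a * b / c\<close> the function \<open>Q_fun\<close> vanishes identically.  Both regions contain
  such triples, so the inequalities can only be non-strict there.
\<close>

lemma gauss_hyp_degenerate:
  fixes a b x :: real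
  assumes "a > 0" "\<bar>x\<bar> < 1"
  shows "gauss_hyp a b a x = (1 - x) powr (- b)"
proof -
  have "(\<lambda>n. ((-b) gchoose n) * (-x) ^ n) sums (1 + (-x)) powr (-b)"
    by (rule gen_binomial_real) (use assms in simp)
  moreover have "((-b) gchoose n) * (-x) ^ n =
      pochhammer a n * pochhammer b n / pochhammer a n * (x ^ n / fact n)" for n
  proof -
    have "pochhammer a n \<noteq> 0" using assms(1) by (metis pochhammer_pos less_irrefl)
    moreover have "(- 1) ^ n * (- x) ^ n = x ^ n"
      by (simp flip: power_mult_distrib)
    ultimately show ?thesis by (simp add: gbinomial_pochhammer)
  qed
  ultimately show ?thesis unfolding gauss_hyp_def by (simp add: sums_iff)
qed
lemma Q_fun_degenerate:
  assumes "a > 0" "q > 1" "0 < x" "x < 1"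
  shows "Q_fun a b a q b n x = 0"
proof -
  have y: "0 < x powr (1/q)" "x powr (1/q) < 1" using assms powr_less_mono2[of "1/q" x 1] by auto
  have one: "(1 - t) powr b * gauss_hyp a b a t = 1" if "\<bar>t\<bar> < 1" for t
    using that by (simp add: gauss_hyp_degenerate[OF assms(1)] flip: powr_add)
  have c: "log_coeff a b a b j = 0" for j
  proof -
    have "\<forall>t. t \<in> {-1<..<1} \<longrightarrow> (deriv ^^ j) (\<lambda>t. ln ((1 - t) powr b * gauss_hyp a b a t)) t = 0"
    proof (induction j)
      case 0 then show ?case by (auto simp: one)
    next
      case (Suc j)
      show ?case
      proof (intro allI impI)
        fix t :: real assume t: "t \<in> {-1<..<1}"
        have "eventually (\<lambda>u. u \<in> {-1<..<1::real}) (nhds t)"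
          using t by (intro eventually_nhds_in_open) auto
        then have "eventually (\<lambda>u. (deriv ^^ j) (\<lambda>t. ln ((1 - t) powr b * gauss_hyp a b a t)) u = (\<lambda>_. 0) u) (nhds t)"
          by eventually_elim (use Suc in auto)
        then show "(deriv ^^ Suc j) (\<lambda>t. ln ((1 - t) powr b * gauss_hyp a b a t)) t = 0"
          using deriv_cong_ev by fastforce
      qed
    qed
    then show ?thesis unfolding log_coeff_def maclaurin_coeff_def by simp
  qed
  show ?thesis unfolding Q_fun_def c using one[of x] one[of "x powr (1/q)"] assms y by simp
qed

end

theory Submission
  imports Defs
begin

text \<open>
  Write \<open>F = \<Sum> f\<^sub>n x\<^sup>n\<close> for the hypergeometric series, \<open>g\<^sub>m\<close> for the coefficients of \<open>F' / F\<close>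
  and \<open>y = x powr (1 / q)\<close>, so that \<open>x < y < 1\<close>. Integrating \<open>F' / F - s / (1 - x)\<close> shows
  that \<open>ln ((1 - x)\<^sup>s F)\<close> has the Maclaurin coefficients \<open>w\<^sub>j = (g\<^bsub>j-1\<^esub> - s) / j\<close>. The finite sum in
  \<open>Q_fun\<close> removes the first terms of the logarithmic series, and what is left is
  \<open>(\<Sum>j>n. w\<^sub>j (x\<^sup>j - y\<^sup>j)) / (y - x)\<close>. As \<open>x\<^sup>j < y\<^sup>j\<close>, everything is decided by how \<open>s\<close> compares
  with \<open>g\<^sub>1, g\<^sub>2, ...\<close> (lemma \<open>Q_fun_sign\<close>).

  The numbers \<open>g\<^sub>m\<close> with \<open>m \<ge> 1\<close> lie between \<open>g\<^sub>0 = a b / c\<close> and \<open>a + b - c\<close>. In both regions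
  \<open>a b \<le> c\<close> follows from the constraints, and together with \<open>a + b - 1 \<le> c\<close> this makes \<open>f\<^sub>n\<close>
  nonincreasing. Hence \<open>(1 - x) F\<close> is one minus a series with nonnegative coefficients, and its
  reciprocal has nonnegative coefficients. On the other hand \<open>(1 - x) F' = \<Sum> r\<^sub>n f\<^sub>n x\<^sup>n\<close>, where
  \<open>r\<^sub>n\<close> is a weighted mean of \<open>a b / c\<close> and \<open>a + b - c\<close>. So the coefficients
  \<open>g\<^sub>m - t\<close> of \<open>F' / F - t / (1 - x) = ((1 - x) F' - t F) / ((1 - x) F)\<close> have a constant sign when
  \<open>t\<close> is one of these two numbers. The sign of \<open>(c - a) (c - b)\<close>, which separates the regions, says
  which of the two is larger.

  In the first region \<open>a + b - c\<close> may be negative, and the lower bound \<open>0\<close> comes from Kaluza's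
  argument (lemma \<open>g_pos\<close>): there \<open>f\<close> is log-convex, and this makes the coefficients of \<open>F' / F\<close>
  positive. The two-sided estimates for \<open>F(x) / F(y)\<close> are the signs of \<open>Q_fun\<close> at the extreme values
  of \<open>s\<close>, with \<open>n = 1\<close>, or with \<open>n = 2\<close> for \<open>s = a b / c\<close>, where \<open>w\<^sub>1\<close> vanishes.
\<close>

section \<open>Power series\<close>

lemma fps_nth_expansion_deriv:
  fixes f :: "'a \<Rightarrow> 'a :: {banach, real_normed_field}"
  assumes "f has_fps_expansion A"
  shows "fps_nth A n = (deriv ^^ n) f 0 / fact n"
  using assms
proof (induction n arbitrary: f A)
  case 0
  then have "eventually (\<lambda>z. eval_fps A z = f z) (nhds 0)"
    by (simp add: has_fps_expansion_def)
  then have "eval_fps A 0 = f 0" by (rule eventually_nhds_x_imp_x)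
  then show ?case by (simp add: eval_fps_at_0)
next
  case (Suc n)
  have "fps_nth (fps_deriv A) n = (deriv ^^ n) (deriv f) 0 / fact n"
    by (intro Suc.IH has_fps_expansion_deriv Suc.prems)
  then have "fps_nth A (Suc n) = (deriv ^^ n) (deriv f) 0 / fact n / of_nat (Suc n)"
    by (simp add: nonzero_eq_divide_eq ac_simps del: of_nat_Suc)
  then show ?case by (simp add: funpow_Suc_right ac_simps del: funpow.simps)
qed

lemma fps_conv_radius_bounded:
  fixes A :: "'a :: {banach, real_normed_div_algebra} fps"
  assumes "\<And>n. norm (fps_nth A n) \<le> B"
  shows "1 \<le> fps_conv_radius A"
  unfolding fps_conv_radius_def one_ereal_def
proof (rule conv_radius_geI_ex')
  fix r :: real assume r: "0 < r" "ereal r < ereal 1"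
  show "summable (\<lambda>n. fps_nth A n * of_real r ^ n)"
  proof (rule summable_comparison_test')
    show "summable (\<lambda>n. B * r ^ n)" using r by (intro summable_mult summable_geometric) auto
    show "norm (fps_nth A n * of_real r ^ n) \<le> B * r ^ n" if "n \<ge> 0" for n
      using assms[of n] r by (simp add: norm_mult norm_power mult_right_mono)
  qed
qed

text \<open>
  The reciprocal of \<open>1 - E\<close> is the geometric series \<open>1 + E + E\<^sup>2 + ...\<close>, so it inherits
  nonnegativity from \<open>E\<close>.
\<close>

lemma inverse_nth_nonneg:
  fixes A :: "'a :: linordered_field fps"
  assumes "fps_nth A 0 = 1" and "\<And>n. n \<ge> 1 \<Longrightarrow> fps_nth A n \<le> 0"
  shows "fps_nth (inverse A) n \<ge> 0"
proof (induction n rule: less_induct)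
  case (less n)
  show ?case
  proof (cases n)
    case 0
    then show ?thesis using assms(1) by simp
  next
    case (Suc m)
    have "fps_nth (inverse A) n = - (\<Sum>i=1..n. fps_nth A i * fps_nth (inverse A) (n - i))"
      unfolding Suc by (simp add: fps_inverse_def assms(1))
    moreover have "(\<Sum>i=1..n. fps_nth A i * fps_nth (inverse A) (n - i)) \<le> 0"
      using assms(2) less by (intro sum_nonpos mult_nonpos_nonneg) auto
    ultimately show ?thesis by simp
  qed
qed

section \<open>Coefficients of the logarithmic derivative\<close>

definition hyp_fps :: "real \<Rightarrow> real \<Rightarrow> real \<Rightarrow> real fps" where
  "hyp_fps a b c = Abs_fps (\<lambda>n. pochhammer a n * pochhammer b n / pochhammer c n / fact n)"

definition hyp_log_deriv :: "real \<Rightarrow> real \<Rightarrow> real \<Rightarrow> real fps" where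
  "hyp_log_deriv a b c = fps_deriv (hyp_fps a b c) * inverse (hyp_fps a b c)"

lemma gauss_hyp_eq_eval_fps: "gauss_hyp a b c x = eval_fps (hyp_fps a b c) x"
  by (simp add: gauss_hyp_def eval_fps_def hyp_fps_def field_simps)

text \<open>
  The two upper bounds on \<open>a * b\<close> and \<open>a + b - 1\<close> are what the regions have in common; they make
  the hypergeometric coefficients nonincreasing.
\<close>

locale decreasing_hypergeometric =
  fixes a b c :: real
  assumes pos: "a > 0" "b > 0" "c > 0"
    and c_ge: "c \<ge> a + b - 1"
    and ab_le: "a * b \<le> c"
begin

abbreviation F where "F \<equiv> hyp_fps a b c"
abbreviation G where "G \<equiv> hyp_log_deriv a b c"
abbreviation f where "f n \<equiv> fps_nth F n"
abbreviation g where "g n \<equiv> fps_nth G n"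

text \<open>
  These are the multipliers that turn \<open>f\<close> into the coefficients of \<open>(1 - x) F'\<close>: the number \<open>r n\<close>
  is the mean of \<open>a * b / c\<close> and \<open>a + b - c\<close> with weights \<open>c\<close> and \<open>n\<close>.
\<close>

definition r :: "nat \<Rightarrow> real" where
  "r n = (a * b + (a + b - c) * n) / (c + n)"

lemma f_0: "f 0 = 1" by (simp add: hyp_fps_def)

lemma f_pos: "f n > 0"
  using pos by (simp add: hyp_fps_def pochhammer_pos)

lemma f_Suc: "(real n + 1) * f (Suc n) = (a + n) * (b + n) / (c + n) * f n"
proof -
  have nz: "pochhammer c n \<noteq> 0" "c + real n \<noteq> 0" "1 + real n \<noteq> 0"
    using pos pochhammer_pos[of c n] by auto
  have "f (Suc n) * (real n + 1) = (a + n) * (b + n) / (c + n) * f n"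
    using nz by (simp add: hyp_fps_def pochhammer_Suc divide_simps)
  then show ?thesis by (simp add: mult.commute)
qed

lemma f_Suc_le: "f (Suc n) \<le> f n"
proof -
  \<comment> \<open>the quotient of consecutive coefficients is at most 1 exactly when \<open>a * b - c \<le> (c - (a + b - 1)) * n\<close>\<close>
  have "(c - (a + b - 1)) * n \<ge> 0" using c_ge by (intro mult_nonneg_nonneg) auto
  then have "(a + n) * (b + n) \<le> (c + n) * (real n + 1)"
    using ab_le by (simp add: algebra_simps)
  then have "(a + n) * (b + n) / (c + n) \<le> real n + 1"
    using pos by (simp add: divide_le_eq mult.commute)
  then have "(real n + 1) * f (Suc n) \<le> (real n + 1) * f n"
    unfolding f_Suc using f_pos[of n] by (intro mult_right_mono) auto
  then show ?thesis by (simp add: mult_le_cancel_left)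
qed

lemma f_le_1: "f n \<le> 1"
  using f_0 lift_Suc_antimono_le[of f 0 n, OF f_Suc_le] by simp

lemma G_mult_F: "G * F = fps_deriv F"
  using f_0 by (simp add: hyp_log_deriv_def mult.assoc inverse_mult_eq_1)

lemma g_0: "g 0 = a * b / c"
  using f_Suc[of 0] f_0 by (simp add: hyp_log_deriv_def)

definition \<gamma> :: "nat \<Rightarrow> real" where
  "\<gamma> n = fps_nth (inverse ((1 - fps_X) * F)) n"

lemma \<gamma>_0: "\<gamma> 0 = 1" by (simp add: \<gamma>_def f_0)

lemma \<gamma>_nonneg: "\<gamma> n \<ge> 0"
  unfolding \<gamma>_def
proof (rule inverse_nth_nonneg)
  show "fps_nth ((1 - fps_X) * F) 0 = 1" by (simp add: f_0)
  show "fps_nth ((1 - fps_X) * F) n \<le> 0" if "n \<ge> 1" for n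
    using that f_Suc_le[of "n - 1"] by (simp add: left_diff_distrib)
qed

lemma one_minus_X_deriv_nth: "fps_nth ((1 - fps_X) * fps_deriv F) n = r n * f n"
proof -
  have "fps_nth ((1 - fps_X) * fps_deriv F) n = (real n + 1) * f (Suc n) - n * f n"
    by (cases n) (simp_all add: left_diff_distrib)
  also have "\<dots> = r n * f n"
    unfolding f_Suc r_def using pos by (simp add: field_simps)
  finally show ?thesis .
qed

text \<open>
  This compares coefficients in \<open>F' / F - t / (1 - x) = ((1 - x) F' - t F) / ((1 - x) F)\<close>. Since
  \<open>f\<close> and \<open>\<gamma>\<close> are nonnegative, bounds on the explicit numbers \<open>r i\<close> become bounds on \<open>g m\<close>.
\<close>

lemma g_minus_const: "g m - t = (\<Sum>i=0..m. (r i - t) * f i * \<gamma> (m - i))"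
proof -
  define P where "P = (1 - fps_X :: real fps) * F"
  have P0: "fps_nth P 0 \<noteq> 0" by (simp add: P_def f_0)
  define U :: "real fps" where "U = Abs_fps (\<lambda>_. 1)"
  have U: "(1 - fps_X) * U = 1"
    by (rule fps_ext) (simp add: U_def left_diff_distrib)
  have "G - fps_const t * U = (G - fps_const t * U) * (P * inverse P)"
    using inverse_mult_eq_1'[OF P0] by simp
  also have "(G - fps_const t * U) * (P * inverse P)
      = ((1 - fps_X) * (G * F) - fps_const t * ((1 - fps_X) * U) * F) * inverse P"
    by (simp add: P_def algebra_simps)
  also have "\<dots> = ((1 - fps_X) * fps_deriv F - fps_const t * F) * inverse P"
    by (simp add: G_mult_F U)
  finally have "fps_nth (G - fps_const t * U) m
     = fps_nth (((1 - fps_X) * fps_deriv F - fps_const t * F) * inverse P) m" by simp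
  also have "\<dots> = (\<Sum>i=0..m. (r i * f i - t * f i) * \<gamma> (m - i))"
    unfolding fps_mult_nth[of _ "inverse P"] by (simp add: one_minus_X_deriv_nth \<gamma>_def P_def)
  finally show ?thesis by (simp add: U_def left_diff_distrib)
qed

text \<open>
  In the next two lemmas the summand with \<open>i = m\<close> is kept, because \<open>\<gamma> 0 = 1\<close> turns a strict
  inequality for \<open>r m\<close> into a strict one for \<open>g m\<close>.
\<close>

lemma g_ge:
  assumes "\<And>i. r i \<ge> t"
  shows "g m \<ge> t + (r m - t) * f m"
proof -
  have "(r m - t) * f m * \<gamma> (m - m) \<le> (\<Sum>i=0..m. (r i - t) * f i * \<gamma> (m - i))"
    using assms f_pos \<gamma>_nonneg less_imp_le[OF f_pos]
    by (intro member_le_sum[where f="\<lambda>i. (r i - t) * f i * \<gamma> (m - i)"]) auto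
  then show ?thesis by (simp add: \<gamma>_0 flip: g_minus_const)
qed

lemma g_le:
  assumes "\<And>i. r i \<le> t"
  shows "g m \<le> t + (r m - t) * f m"
proof -
  have "(t - r m) * f m * \<gamma> (m - m) \<le> (\<Sum>i=0..m. (t - r i) * f i * \<gamma> (m - i))"
    using assms f_pos \<gamma>_nonneg less_imp_le[OF f_pos]
    by (intro member_le_sum[where f="\<lambda>i. (t - r i) * f i * \<gamma> (m - i)"]) auto
  also have "\<dots> = - (g m - t)"
    unfolding g_minus_const sum_negf[symmetric] by (simp add: algebra_simps)
  finally show ?thesis by (simp add: \<gamma>_0 algebra_simps)
qed

lemma r_minus_limit: "r n - (a + b - c) = (c - a) * (c - b) / (c + n)"
proof -
  have "c + n \<noteq> 0" using pos by (auto simp: add_pos_nonneg)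
  then show ?thesis by (simp add: r_def divide_simps) (simp add: algebra_simps)
qed

lemma r_minus_initial: "a * b / c - r n = (c - a) * (c - b) * n / (c * (c + n))"
proof -
  have "c * (c + n) \<noteq> 0" "c \<noteq> 0" "c + n \<noteq> 0" using pos by (auto simp: add_pos_nonneg)
  then show ?thesis by (simp add: r_def divide_simps) (simp add: algebra_simps)
qed

text \<open>
  The upper bound is strict only for \<open>m \<ge> 1\<close>, since \<open>g 0 = a * b / c\<close>. For
  \<open>(c - a) * (c - b) = 0\<close> both bounds coincide and all \<open>g m\<close> are equal.
\<close>

lemma g_bounds_if_nonneg:
  assumes D: "(c - a) * (c - b) \<ge> 0"
  shows "a + b - c \<le> g m" "g m \<le> a * b / c"
    and "(c - a) * (c - b) \<noteq> 0 \<Longrightarrow> a + b - c < g m"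
    and "(c - a) * (c - b) \<noteq> 0 \<Longrightarrow> m \<ge> 1 \<Longrightarrow> g m < a * b / c"
proof -
  have lo: "r i \<ge> a + b - c" for i
  proof -
    have "(c - a) * (c - b) / (c + i) \<ge> 0" using D pos by (intro divide_nonneg_pos) auto
    then show ?thesis unfolding r_minus_limit[symmetric] by simp
  qed
  have hi: "r i \<le> a * b / c" for i
  proof -
    have "(c - a) * (c - b) * i / (c * (c + i)) \<ge> 0"
      using D pos by (intro divide_nonneg_pos mult_pos_pos mult_nonneg_nonneg[of _ "real i"]) auto
    then show ?thesis unfolding r_minus_initial[symmetric] by simp
  qed
  have lo': "a + b - c + (r m - (a + b - c)) * f m \<le> g m" by (rule g_ge[OF lo])
  have hi': "g m \<le> a * b / c + (r m - a * b / c) * f m" by (rule g_le[OF hi])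
  show "a + b - c \<le> g m"
    using lo' mult_nonneg_nonneg[of "r m - (a + b - c)" "f m"] lo[of m] f_pos[of m] by linarith
  show "g m \<le> a * b / c"
    using hi' mult_nonpos_nonneg[of "r m - a * b / c" "f m"] hi[of m] f_pos[of m] by linarith
  assume "(c - a) * (c - b) \<noteq> 0"
  with D have D': "(c - a) * (c - b) > 0" by (metis order_less_le)
  have "(c - a) * (c - b) / (c + m) > 0" using D' pos by (intro divide_pos_pos) auto
  then have "(r m - (a + b - c)) * f m > 0"
    unfolding r_minus_limit[symmetric] using f_pos by simp
  then show "a + b - c < g m" using lo' by linarith
  assume "m \<ge> 1"
  then have "(c - a) * (c - b) * m / (c * (c + m)) > 0"
    using D' pos by (intro divide_pos_pos mult_pos_pos[of _ "real m"] mult_pos_pos[of c]) auto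
  then have "(a * b / c - r m) * f m > 0"
    unfolding r_minus_initial[symmetric] using f_pos by simp
  then show "g m < a * b / c" using hi' by (simp add: algebra_simps)
qed

lemma g_bounds_if_nonpos:
  assumes D: "(c - a) * (c - b) \<le> 0"
  shows "a * b / c \<le> g m" "g m \<le> a + b - c"
    and "(c - a) * (c - b) \<noteq> 0 \<Longrightarrow> g m < a + b - c"
    and "(c - a) * (c - b) \<noteq> 0 \<Longrightarrow> m \<ge> 1 \<Longrightarrow> a * b / c < g m"
proof -
  have hi: "r i \<le> a + b - c" for i
  proof -
    have "(c - a) * (c - b) / (c + i) \<le> 0" using D pos by (intro divide_nonpos_pos) auto
    then show ?thesis unfolding r_minus_limit[symmetric] by simp
  qed
  have lo: "r i \<ge> a * b / c" for i
  proof -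
    have "(c - a) * (c - b) * i / (c * (c + i)) \<le> 0"
      using D pos by (intro divide_nonpos_pos mult_pos_pos mult_nonpos_nonneg[of _ "real i"]) auto
    then show ?thesis unfolding r_minus_initial[symmetric] by simp
  qed
  have hi': "g m \<le> a + b - c + (r m - (a + b - c)) * f m" by (rule g_le[OF hi])
  have lo': "a * b / c + (r m - a * b / c) * f m \<le> g m" by (rule g_ge[OF lo])
  show "g m \<le> a + b - c"
    using hi' mult_nonpos_nonneg[of "r m - (a + b - c)" "f m"] hi[of m] f_pos[of m] by linarith
  show "a * b / c \<le> g m"
    using lo' mult_nonneg_nonneg[of "r m - a * b / c" "f m"] lo[of m] f_pos[of m] by linarith
  assume "(c - a) * (c - b) \<noteq> 0"
  with D have D': "(c - a) * (c - b) < 0" by (metis order_less_le)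
  have "(c - a) * (c - b) / (c + m) < 0" using D' pos by (intro divide_neg_pos) auto
  then have "(r m - (a + b - c)) * f m < 0"
    unfolding r_minus_limit[symmetric] using f_pos by (intro mult_neg_pos)
  then show "g m < a + b - c" using hi' by linarith
  assume "m \<ge> 1"
  then have "(c - a) * (c - b) * m / (c * (c + m)) < 0"
    using D' pos by (intro divide_neg_pos mult_neg_pos[of _ "real m"] mult_pos_pos[of c]) auto
  then have "(a * b / c - r m) * f m < 0"
    unfolding r_minus_initial[symmetric] using f_pos by (intro mult_neg_pos)
  then show "a * b / c < g m" using lo' by (simp add: algebra_simps)
qed

lemma g_1: "g 1 = a * b / c - a * b * (c - a) * (c - b) / (c\<^sup>2 * (c + 1))"
proof -
  have nz: "c \<noteq> 0" "c + 1 \<noteq> 0" using pos by auto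
  have "g 1 - a * b / c = (r 1 - a * b / c) * f 1"
    unfolding g_minus_const using r_minus_initial[of 0] by (simp add: \<gamma>_0)
  also have "r 1 - a * b / c = - ((c - a) * (c - b) / (c * (c + 1)))"
    using r_minus_initial[of 1] by simp
  also have "f 1 = a * b / c" using f_Suc[of 0] by (simp add: f_0)
  finally show ?thesis using nz by (simp add: power2_eq_square divide_simps) (simp add: algebra_simps)
qed

text \<open>
  Kaluza's argument. Under the assumption the quotients \<open>\<rho> k = f (Suc k) / f k\<close> are
  nondecreasing. In \<open>(n + 1) * f (Suc n) = (\<Sum>k\<le>n. g k * f (n - k))\<close> the summands with \<open>k < n\<close>
  are, by induction, at most \<open>\<rho> (n - 1)\<close> times the summands of the same identity for \<open>n - 1\<close>.
  Their total is therefore less than the left-hand side, which leaves a positive \<open>g n\<close>.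
\<close>

lemma g_pos:
  assumes L: "2 * a * b \<le> (1 + a + b - a * b) * c"
  shows "g n > 0"
proof (induction n rule: less_induct)
  case (less n)
  have conv: "(real n + 1) * f (Suc n) = (\<Sum>k=0..n. g k * f (n - k))" for n
    using arg_cong[OF G_mult_F, of "\<lambda>A. fps_nth A n"] by (simp add: fps_mult_nth)
  define \<rho> where "\<rho> k = f (Suc k) / f k" for k
  have \<rho>_eq: "\<rho> k = (a + k) * (b + k) / ((c + k) * (real k + 1))" for k
  proof -
    have "f (Suc k) = (a + k) * (b + k) / (c + k) * f k / (real k + 1)"
      unfolding f_Suc[symmetric] by simp
    then show ?thesis unfolding \<rho>_def using f_pos[of k] by simp
  qed
  have \<rho>_Suc: "\<rho> k \<le> \<rho> (Suc k)" for k
  proof -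
    \<comment> \<open>a polynomial in \<open>k\<close>, with coefficients that are nonnegative by \<open>c_ge\<close>, \<open>ab_le\<close> and \<open>L\<close>\<close>
    have "(a + Suc k) * (b + Suc k) * ((c + k) * (real k + 1))
          - (a + k) * (b + k) * ((c + Suc k) * (real (Suc k) + 1))
        = (c - (a + b - 1)) * k\<^sup>2 + ((c - (a + b - 1)) + 2 * (c - a * b)) * k
          + ((1 + a + b - a * b) * c - 2 * a * b)"
      by (simp add: algebra_simps power2_eq_square)
    also have "\<dots> \<ge> 0" using L c_ge ab_le by (intro add_nonneg_nonneg mult_nonneg_nonneg) auto
    finally have "(a + k) * (b + k) * ((c + Suc k) * (real (Suc k) + 1))
        \<le> (a + Suc k) * (b + Suc k) * ((c + k) * (real k + 1))" by simp
    moreover have "(c + k) * (real k + 1) > 0" "(c + Suc k) * (real (Suc k) + 1) > 0"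
      using pos by (auto intro!: mult_pos_pos)
    ultimately show ?thesis unfolding \<rho>_eq by (subst frac_le_eq) (auto intro!: divide_nonpos_pos)
  qed
  have \<rho>_mono: "\<rho> i \<le> \<rho> j" if "i \<le> j" for i j
    using lift_Suc_mono_le[of \<rho>, OF \<rho>_Suc that] .
  have \<rho>_pos: "\<rho> k > 0" for k unfolding \<rho>_def using f_pos by simp
  show ?case
  proof (cases n)
    case 0
    then show ?thesis using g_0 pos by simp
  next
    case (Suc m)
    have "(\<Sum>k=0..m. g k * f (Suc m - k)) \<le> (\<Sum>k=0..m. \<rho> m * (g k * f (m - k)))"
    proof (rule sum_mono)
      fix k assume k: "k \<in> {0..m}"
      have "f (Suc m - k) = \<rho> (m - k) * f (m - k)"
        using k f_pos[of "m - k"] unfolding \<rho>_def by (simp add: Suc_diff_le)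
      also have "\<dots> \<le> \<rho> m * f (m - k)"
        using \<rho>_mono[of "m - k" m] f_pos[of "m - k"] by (intro mult_right_mono) auto
      finally have "g k * f (Suc m - k) \<le> g k * (\<rho> m * f (m - k))"
        using less.IH[of k] k Suc by (intro mult_left_mono) auto
      then show "g k * f (Suc m - k) \<le> \<rho> m * (g k * f (m - k))" by (simp add: mult_ac)
    qed
    also have "\<dots> = \<rho> m * ((real m + 1) * f (Suc m))"
      unfolding conv sum_distrib_left ..
    also have "\<dots> < \<rho> n * ((real n + 1) * f n)"
    proof -
      have "\<rho> m * ((real m + 1) * f (Suc m)) < \<rho> m * ((real n + 1) * f n)"
        using \<rho>_pos[of m] f_pos[of n] Suc by (intro mult_strict_left_mono mult_strict_right_mono) auto
      also have "\<dots> \<le> \<rho> n * ((real n + 1) * f n)"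
        using \<rho>_mono[of m n] f_pos[of n] Suc by (intro mult_right_mono) auto
      finally show ?thesis .
    qed
    also have "\<dots> = (real n + 1) * f (Suc n)"
      using f_pos[of n] unfolding \<rho>_def by simp
    also have "\<dots> = (\<Sum>k=0..m. g k * f (Suc m - k)) + g n"
      unfolding conv by (simp add: Suc f_0)
    finally show ?thesis by simp
  qed
qed

section \<open>The logarithmic power series\<close>

lemma abs_g_le: "\<bar>g m\<bar> \<le> \<bar>a * b / c\<bar> + \<bar>a + b - c\<bar>"
proof (cases "(c - a) * (c - b) \<ge> 0")
  case True
  then show ?thesis using g_bounds_if_nonneg(1,2)[of m] by linarith
next
  case False
  then show ?thesis using g_bounds_if_nonpos(1,2)[of m] by linarith
qed

definition w_fps :: "real \<Rightarrow> real fps" where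
  "w_fps s = Abs_fps (\<lambda>j. if j = 0 then 0 else (g (j - 1) - s) / j)"

lemma w_fps_conv_radius: "1 \<le> fps_conv_radius (w_fps s)"
proof (rule fps_conv_radius_bounded)
  show "norm (fps_nth (w_fps s) j) \<le> \<bar>a * b / c\<bar> + \<bar>a + b - c\<bar> + \<bar>s\<bar>" for j
  proof (cases j)
    case (Suc m)
    have "\<bar>fps_nth (w_fps s) j\<bar> = \<bar>g m - s\<bar> / (real m + 1)"
      by (simp add: w_fps_def Suc add.commute)
    also have "\<dots> \<le> \<bar>g m - s\<bar>" by (simp add: divide_le_eq ring_distribs)
    also have "\<dots> \<le> \<bar>g m\<bar> + \<bar>s\<bar>" by simp
    finally show ?thesis using abs_g_le[of m] unfolding real_norm_def by linarith
  qed (simp add: w_fps_def)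
qed

lemma F_conv_radius: "1 \<le> fps_conv_radius F"
  by (rule fps_conv_radius_bounded[of _ 1]) (use f_le_1 less_imp_le[OF f_pos] in auto)

lemma G_conv_radius: "1 \<le> fps_conv_radius G"
  by (rule fps_conv_radius_bounded) (unfold real_norm_def, rule abs_g_le)

text \<open>
  The quotient of the two sides has derivative \<open>0\<close>, because the derivative of \<open>w_fps s\<close> is
  \<open>F' / F - s / (1 - x)\<close>. Stating this with \<open>exp\<close> instead of \<open>ln\<close> also yields that \<open>F\<close> is positive
  on the whole interval of convergence, including negative arguments; the derivatives at \<open>0\<close> in
  \<open>log_coeff\<close> require the logarithm in a two-sided neighbourhood.
\<close>

lemma powr_times_hyp_eq_exp:
  assumes x: "\<bar>x\<bar> < 1"
  shows "(1 - x) powr s * gauss_hyp a b c x = exp (eval_fps (w_fps s) x)"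
proof -
  have inr: "ereal (norm y) < fps_conv_radius A" if "\<bar>y\<bar> < 1" "1 \<le> fps_conv_radius A"
    for y :: real and A :: "real fps"
    using that by (metis ereal_less(3) less_le_trans real_norm_def one_ereal_def less_ereal.simps(1))
  define \<phi> where "\<phi> y = (1 - y) powr s * eval_fps F y * exp (- eval_fps (w_fps s) y)" for y
  have w': "eval_fps (fps_deriv (w_fps s)) y = eval_fps G y - s / (1 - y)" if y: "\<bar>y\<bar> < 1" for y
  proof -
    have "(\<lambda>n. g n * y ^ n - s * y ^ n) sums (eval_fps G y - s * (1 / (1 - y)))"
      using y by (intro sums_diff sums_mult sums_eval_fps geometric_sums inr G_conv_radius) auto
    moreover have "fps_nth (fps_deriv (w_fps s)) n = g n - s" for n
      by (simp add: w_fps_def)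
    ultimately show ?thesis
      unfolding eval_fps_def[of "fps_deriv (w_fps s)"] by (simp add: left_diff_distrib sums_iff)
  qed
  have "(\<phi> has_field_derivative 0) (at y within {-1<..<1})" if y: "y \<in> {-1<..<1}" for y
  proof -
    from y have y: "\<bar>y\<bar> < 1" by auto
    have FG: "eval_fps (fps_deriv F) y = eval_fps G y * eval_fps F y"
      using y unfolding G_mult_F[symmetric]
      by (intro eval_fps_mult inr G_conv_radius F_conv_radius)
    have dF: "(eval_fps F has_field_derivative eval_fps G y * eval_fps F y) (at y within {-1<..<1})"
      unfolding FG[symmetric] by (intro has_field_derivative_eval_fps inr y F_conv_radius)
    have dW: "(eval_fps (w_fps s) has_field_derivative eval_fps G y - s / (1 - y)) (at y within {-1<..<1})"
      unfolding w'[OF y, symmetric] by (intro has_field_derivative_eval_fps inr y w_fps_conv_radius)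
    have dP: "((\<lambda>y. (1 - y) powr s) has_field_derivative - s / (1 - y) * (1 - y) powr s) (at y within {-1<..<1})"
      using y by (auto intro!: derivative_eq_intros simp: powr_diff)
    show ?thesis unfolding \<phi>_def
      by (rule derivative_eq_intros dF dW dP refl)+ (simp add: algebra_simps)
  qed
  then obtain k where k: "\<And>y. y \<in> {-1<..<1} \<Longrightarrow> \<phi> y = k"
    using has_field_derivative_zero_constant[of "{-1<..<1}" \<phi>] by auto
  have "\<phi> 0 = 1" by (simp add: \<phi>_def eval_fps_at_0 f_0 w_fps_def)
  then have "\<phi> x = 1" using k[of 0] k[of x] x by (simp add: abs_less_iff)
  then show ?thesis
    by (simp add: \<phi>_def gauss_hyp_eq_eval_fps exp_minus field_simps)
qed

lemma log_coeff_eq: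
  assumes "j \<ge> 1"
  shows "log_coeff a b c s j = (g (j - 1) - s) / j"
proof -
  have "eventually (\<lambda>z. z \<in> {-1<..<1::real}) (nhds 0)"
    by (intro eventually_nhds_in_open) auto
  then have "eventually (\<lambda>z. eval_fps (w_fps s) z = ln ((1 - z) powr s * gauss_hyp a b c z)) (nhds 0)"
    by eventually_elim (auto simp: powr_times_hyp_eq_exp)
  then have "(\<lambda>z. ln ((1 - z) powr s * gauss_hyp a b c z)) has_fps_expansion w_fps s"
    unfolding has_fps_expansion_def
    using w_fps_conv_radius[of s] less_le_trans[of 0 "1::ereal"] by auto
  from fps_nth_expansion_deriv[OF this, of j] show ?thesis
    using assms by (simp add: log_coeff_def maclaurin_coeff_def w_fps_def)
qed

lemma gauss_hyp_pos: "\<bar>x\<bar> < 1 \<Longrightarrow> gauss_hyp a b c x > 0"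
  using powr_times_hyp_eq_exp[of x 0] by (cases "x = 1") auto

lemma log_tail_sums:
  assumes x: "0 < x" "x < 1" and y: "0 < y" "y < 1"
  shows "(\<lambda>i. log_coeff a b c s (i + Suc n) * (x ^ (i + Suc n) - y ^ (i + Suc n))) sums
     (ln ((1 - x) powr s * gauss_hyp a b c x / ((1 - y) powr s * gauss_hyp a b c y))
       - (\<Sum>j=1..n. log_coeff a b c s j * (x ^ j - y ^ j)))"
proof -
  let ?w = "fps_nth (w_fps s)"
  have inr: "ereal (norm z) < fps_conv_radius (w_fps s)" if "0 < z" "z < 1" for z :: real
  proof -
    have "ereal (norm z) < 1" using that by (simp add: one_ereal_def)
    then show ?thesis using w_fps_conv_radius by (rule less_le_trans)
  qed
  have w: "?w j = log_coeff a b c s j" if "j \<ge> 1" for j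
    using that by (simp add: log_coeff_eq w_fps_def)
  have "(\<lambda>j. ?w j * x ^ j - ?w j * y ^ j) sums (eval_fps (w_fps s) x - eval_fps (w_fps s) y)"
    by (intro sums_diff sums_eval_fps inr x y)
  then have "(\<lambda>j. ?w j * (x ^ j - y ^ j)) sums (eval_fps (w_fps s) x - eval_fps (w_fps s) y)"
    by (simp add: right_diff_distrib)
  from sums_split_initial_segment[OF this, of "Suc n"]
  have "(\<lambda>i. ?w (i + Suc n) * (x ^ (i + Suc n) - y ^ (i + Suc n))) sums
     (eval_fps (w_fps s) x - eval_fps (w_fps s) y - (\<Sum>j<Suc n. ?w j * (x ^ j - y ^ j)))" .
  moreover have "(\<Sum>j<Suc n. ?w j * (x ^ j - y ^ j)) = (\<Sum>j=1..n. log_coeff a b c s j * (x ^ j - y ^ j))"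
  proof -
    have "{..<Suc n} = insert 0 {1..n}" by auto
    then show ?thesis by (simp add: w)
  qed
  moreover have "ln ((1 - x) powr s * gauss_hyp a b c x / ((1 - y) powr s * gauss_hyp a b c y))
      = eval_fps (w_fps s) x - eval_fps (w_fps s) y"
    using x y by (simp add: powr_times_hyp_eq_exp flip: exp_diff)
  moreover have "?w (i + Suc n) = log_coeff a b c s (i + Suc n)" for i by (rule w) simp
  ultimately show ?thesis by simp
qed

lemma Q_fun_eq:
  assumes "0 < x" "x < 1" "q > 1"
  defines "y \<equiv> x powr (1 / q)"
  shows "Q_fun a b c q s n x = (\<Sum>i. log_coeff a b c s (i + Suc n) * (x ^ (i + Suc n) - y ^ (i + Suc n))) / (y - x)"
    and "x < y" "y < 1"
proof -
  have y: "0 < y" using assms by (simp add: y_def)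
  have "x powr 1 < x powr (1 / q)"
    using assms by (intro powr_less_mono') auto
  then show "x < y" using assms by (simp add: y_def)
  show y1: "y < 1" using assms powr_less_mono2[of "1/q" x 1] by (simp add: y_def)
  have pw: "x powr (real j / q) = y ^ j" for j
    using y assms by (simp add: y_def powr_powr flip: powr_realpow)
  have factor: "1 / d * A - (\<Sum>j=1..n. w j * (v j / d)) = (A - (\<Sum>j=1..n. w j * v j)) / d"
    for d A :: real and w v :: "nat \<Rightarrow> real"
    by (simp add: diff_divide_distrib sum_divide_distrib)
  show "Q_fun a b c q s n x = (\<Sum>i. log_coeff a b c s (i + Suc n) * (x ^ (i + Suc n) - y ^ (i + Suc n))) / (y - x)"
    unfolding sums_unique[OF log_tail_sums[OF assms(1,2) y y1], symmetric]
      Q_fun_def y_def[symmetric] pw factor ..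
qed

lemma log_coeff_mult_diff:
  assumes "j \<ge> 1"
  shows "log_coeff a b c s j * (x ^ j - y ^ j) = (s - g (j - 1)) * ((y ^ j - x ^ j) / j)"
  using assms by (simp add: log_coeff_eq field_simps)

lemma Q_fun_sign:
  assumes n: "n \<ge> 1" and q: "q > 1" and x: "0 < x" "x < 1"
  shows "(\<And>m. m \<ge> 1 \<Longrightarrow> s < g m) \<Longrightarrow> Q_fun a b c q s n x < 0"
    and "(\<And>m. m \<ge> 1 \<Longrightarrow> g m < s) \<Longrightarrow> Q_fun a b c q s n x > 0"
    and "(\<And>m. m \<ge> 1 \<Longrightarrow> g m = s) \<Longrightarrow> Q_fun a b c q s n x = 0"
proof -
  define y where "y = x powr (1 / q)"
  note Q = Q_fun_eq[OF x q, folded y_def]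
  have y0: "0 < y" using x by (simp add: y_def)
  define u where "u i = log_coeff a b c s (i + Suc n) * (x ^ (i + Suc n) - y ^ (i + Suc n))" for i
  have u: "u i = (s - g (i + n)) * ((y ^ (i + Suc n) - x ^ (i + Suc n)) / real (i + Suc n))" for i
    unfolding u_def by (subst log_coeff_mult_diff) auto
  have pw: "(y ^ (i + Suc n) - x ^ (i + Suc n)) / real (i + Suc n) > 0" for i
    using power_strict_mono[of x y "i + Suc n"] Q(2) x by (intro divide_pos_pos) auto
  have "summable u"
    using log_tail_sums[OF x y0 Q(3)] unfolding u_def by (rule sums_summable)
  have Qu: "Q_fun a b c q s n x = (\<Sum>i. u i) / (y - x)" unfolding Q(1) u_def ..
  {
    assume g: "\<And>m. m \<ge> 1 \<Longrightarrow> s < g m"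
    have "u i < 0" for i unfolding u using g[of "i + n"] n pw[of i] by (intro mult_neg_pos) auto
    then have "0 < (\<Sum>i. - u i)"
      using \<open>summable u\<close> by (intro suminf_pos summable_minus) auto
    then show "Q_fun a b c q s n x < 0"
      unfolding Qu using Q(2) \<open>summable u\<close> by (intro divide_neg_pos) (auto simp: suminf_minus)
  }
  {
    assume g: "\<And>m. m \<ge> 1 \<Longrightarrow> g m < s"
    have "u i > 0" for i unfolding u using g[of "i + n"] n pw[of i] by (intro mult_pos_pos) auto
    then have "0 < (\<Sum>i. u i)" using \<open>summable u\<close> by (intro suminf_pos) auto
    then show "Q_fun a b c q s n x > 0"
      unfolding Qu using Q(2) by (intro divide_pos_pos) auto
  }
  {
    assume g: "\<And>m. m \<ge> 1 \<Longrightarrow> g m = s"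
    then have "u = (\<lambda>_. 0)" using n by (auto simp: u)
    then show "Q_fun a b c q s n x = 0" unfolding Qu by simp
  }
qed

text \<open>
  Solving the definition of \<open>Q_fun\<close> for the quotient of the hypergeometric values makes every sign
  of \<open>Q_fun\<close>, strict or not, an inequality for that quotient.
\<close>

lemma hyp_ratio_eq:
  assumes "q > 1" and x: "0 < x" "x < 1"
  defines "y \<equiv> x powr (1 / q)"
  shows "gauss_hyp a b c x / gauss_hyp a b c y = ((1 - y) / (1 - x)) powr s *
    exp ((\<Sum>j=1..n. log_coeff a b c s j * (x ^ j - y ^ j)) + (y - x) * Q_fun a b c q s n x)"
proof -
  have y0: "0 < y" using x by (simp add: y_def)
  note Q = Q_fun_eq[OF x \<open>q > 1\<close>, folded y_def]
  let ?Fx = "gauss_hyp a b c x" and ?Fy = "gauss_hyp a b c y"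
  have pos: "(1 - x) powr s * ?Fx > 0" "(1 - y) powr s * ?Fy > 0" "?Fx > 0" "?Fy > 0"
    using gauss_hyp_pos[of x] gauss_hyp_pos[of y] x y0 Q(3) by auto
  have "(\<Sum>j=1..n. log_coeff a b c s j * (x ^ j - y ^ j)) + (y - x) * Q_fun a b c q s n x
      = ln ((1 - x) powr s * ?Fx / ((1 - y) powr s * ?Fy))"
    unfolding Q(1) sums_unique[OF log_tail_sums[OF x y0 Q(3)], symmetric] using Q(2) by simp
  also have "exp \<dots> = (1 - x) powr s * ?Fx / ((1 - y) powr s * ?Fy)"
    using pos by (intro exp_ln divide_pos_pos)
  finally show ?thesis using pos x Q(3) by (simp add: powr_divide)
qed

section \<open>The thresholds for s\<close>

text \<open>
  Here the series is binomial and both thresholds for \<open>s\<close> agree.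
\<close>

lemma g_degenerate:
  assumes "c = a \<or> c = b"
  shows "g m = a * b / c" "a + b - c = a * b / c"
  using g_bounds_if_nonneg(1,2)[of m] assms pos by auto

lemma product_eq_0_iff: "(c - a) * (c - b) = 0 \<longleftrightarrow> c = a \<or> c = b" by auto

lemma g_gt_max:
  assumes D: "(c - a) * (c - b) \<ge> 0" and L: "2 * a * b \<le> (1 + a + b - a * b) * c"
    and s: "s \<le> max 0 (a + b - c)" "\<not> (s = a * b / c \<and> (c = a \<or> c = b))"
  shows "s < g m"
proof (cases "c = a \<or> c = b")
  case True
  have "a * b / c > 0" using pos by simp
  then show ?thesis using s True g_degenerate(1)[OF True, of m] g_degenerate(2)[OF True] by auto
next
  case False
  then show ?thesis
    using s g_pos[OF L, of m] g_bounds_if_nonneg(3)[OF D, of m] product_eq_0_iff by auto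
qed

lemma g_lt_initial:
  assumes D: "(c - a) * (c - b) \<ge> 0" and m: "m \<ge> 1"
    and s: "s \<ge> a * b / c" "\<not> (s = a * b / c \<and> (c = a \<or> c = b))"
  shows "g m < s"
  using s g_degenerate(1)[of m] g_bounds_if_nonneg(4)[OF D _ m] product_eq_0_iff by fastforce

lemma g_gt_initial:
  assumes D: "(c - a) * (c - b) \<le> 0" and m: "m \<ge> 1"
    and s: "s \<le> a * b / c" "\<not> (s = a * b / c \<and> (c = a \<or> c = b))"
  shows "s < g m"
  using s g_degenerate(1)[of m] g_bounds_if_nonpos(4)[OF D _ m] product_eq_0_iff by fastforce

lemma g_lt_limit:
  assumes D: "(c - a) * (c - b) \<le> 0"
    and s: "s \<ge> a + b - c" "\<not> (s = a * b / c \<and> (c = a \<or> c = b))"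
  shows "g m < s"
  using s g_degenerate(1)[of m] g_degenerate(2) g_bounds_if_nonpos(3)[OF D, of m] product_eq_0_iff by fastforce

lemma Q_fun_degenerate_zero:
  assumes "n \<ge> 1" "q > 1" "0 < x" "x < 1" and "s = a * b / c \<and> (c = a \<or> c = b)"
  shows "Q_fun a b c q s n x = 0"
  using assms g_degenerate(1) by (intro Q_fun_sign(3)) auto

lemma log_coeff_sum_1:
  "(\<Sum>j=1..1. log_coeff a b c s j * (x ^ j - y ^ j)) = (s - a * b / c) * (y - x)"
  using log_coeff_mult_diff[of 1 s x y] by (simp add: g_0)

lemma log_coeff_sum_2:
  "(\<Sum>j=1..2. log_coeff a b c (a * b / c) j * (x ^ j - y ^ j))
     = a * b * (c - a) * (c - b) * (y\<^sup>2 - x\<^sup>2) / (2 * c\<^sup>2 * (c + 1))"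
proof -
  have "(\<Sum>j=1..2. log_coeff a b c (a * b / c) j * (x ^ j - y ^ j))
      = (a * b / c - g 1) * ((y\<^sup>2 - x\<^sup>2) / 2)"
    using log_coeff_mult_diff[of 1 "a * b / c" x y] log_coeff_mult_diff[of 2 "a * b / c" x y]
    by (simp add: numeral_2_eq_2 g_0)
  also have "a * b / c - g 1 = a * b * (c - a) * (c - b) / (c\<^sup>2 * (c + 1))"
    unfolding g_1 by simp
  finally show ?thesis by simp
qed

text \<open>
  \<open>B1 s\<close> and \<open>B2\<close> are the values that \<open>hyp_ratio_eq\<close> gives for a vanishing \<open>Q_fun\<close>, with \<open>n = 1\<close>
  and with \<open>n = 2\<close>, \<open>s = a * b / c\<close>.
\<close>

lemma hyp_ratio_bounds:
  assumes q: "q > 1" and x: "0 < x" "x < 1"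
  defines "y \<equiv> x powr (1 / q)"
  defines "M \<equiv> gauss_hyp a b c x / gauss_hyp a b c y"
    and "B1 \<equiv> (\<lambda>s. ((1 - y) / (1 - x)) powr s * exp ((s - a * b / c) * (y - x)))"
    and "B2 \<equiv> ((1 - y) / (1 - x)) powr (a * b / c) *
       exp (a * b * (c - a) * (c - b) * (y\<^sup>2 - x\<^sup>2) / (2 * c\<^sup>2 * (c + 1)))"
  shows "Q_fun a b c q s 1 x < 0 \<longleftrightarrow> M < B1 s" "Q_fun a b c q s 1 x \<le> 0 \<longleftrightarrow> M \<le> B1 s"
    and "Q_fun a b c q s 1 x > 0 \<longleftrightarrow> M > B1 s" "Q_fun a b c q s 1 x \<ge> 0 \<longleftrightarrow> M \<ge> B1 s"
    and "Q_fun a b c q (a * b / c) 2 x < 0 \<longleftrightarrow> M < B2"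
    and "Q_fun a b c q (a * b / c) 2 x \<le> 0 \<longleftrightarrow> M \<le> B2"
    and "Q_fun a b c q (a * b / c) 2 x > 0 \<longleftrightarrow> M > B2"
    and "Q_fun a b c q (a * b / c) 2 x \<ge> 0 \<longleftrightarrow> M \<ge> B2"
proof -
  note Q = Q_fun_eq[OF x q, folded y_def]
  have d: "y - x > 0" using Q by simp
  have pos: "B1 s > 0" "B2 > 0" using Q x by (simp_all add: B1_def B2_def)
  have M1: "M = B1 s * exp ((y - x) * Q_fun a b c q s 1 x)"
    unfolding M_def y_def B1_def hyp_ratio_eq[OF q x, of s 1] log_coeff_sum_1
    by (simp add: exp_add)
  have M2: "M = B2 * exp ((y - x) * Q_fun a b c q (a * b / c) 2 x)"
    unfolding M_def y_def B2_def hyp_ratio_eq[OF q x, of "a * b / c" 2] log_coeff_sum_2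
    by (simp add: exp_add)
  show "Q_fun a b c q s 1 x < 0 \<longleftrightarrow> M < B1 s" "Q_fun a b c q s 1 x \<le> 0 \<longleftrightarrow> M \<le> B1 s"
    "Q_fun a b c q s 1 x > 0 \<longleftrightarrow> M > B1 s" "Q_fun a b c q s 1 x \<ge> 0 \<longleftrightarrow> M \<ge> B1 s"
    unfolding M1 using pos d by (simp_all add: mult_less_0_iff mult_le_0_iff zero_less_mult_iff zero_le_mult_iff)
  show "Q_fun a b c q (a * b / c) 2 x < 0 \<longleftrightarrow> M < B2"
    "Q_fun a b c q (a * b / c) 2 x \<le> 0 \<longleftrightarrow> M \<le> B2"
    "Q_fun a b c q (a * b / c) 2 x > 0 \<longleftrightarrow> M > B2"
    "Q_fun a b c q (a * b / c) 2 x \<ge> 0 \<longleftrightarrow> M \<ge> B2"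
    unfolding M2 using pos d by (simp_all add: mult_less_0_iff mult_le_0_iff zero_less_mult_iff zero_le_mult_iff)
qed

end

section \<open>Both regions\<close>

text \<open>
  If \<open>(1 - a) * (1 - b) \<ge> 0\<close>, then \<open>1 + a + b - a * b \<le> 2\<close> and \<open>a * b \<le> c\<close> follows from
  \<open>2 * a * b \<le> (1 + a + b - a * b) * c\<close>; otherwise \<open>a * b < a + b - 1 \<le> c\<close>.
\<close>

lemma region1_decreasing:
  assumes "(a, b, c) \<in> region1"
  shows "decreasing_hypergeometric a b c"
proof
  show "a > 0" "b > 0" "c > 0" "c \<ge> a + b - 1" using assms by (auto simp: region1_def)
  have L: "2 * (a * b) \<le> (1 + a + b - a * b) * c" using assms by (simp add: region1_def mult.assoc)
  show "a * b \<le> c"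
  proof (cases "(1 - a) * (1 - b) \<ge> 0")
    case True
    then have "(1 + a + b - a * b) * c \<le> 2 * c"
      using \<open>c > 0\<close> by (intro mult_right_mono) (auto simp: algebra_simps)
    then show ?thesis using L by linarith
  next
    case False
    then show ?thesis using \<open>c \<ge> a + b - 1\<close> by (simp add: algebra_simps)
  qed
qed

text \<open>
  Here \<open>c\<close> lies between \<open>a\<close> and \<open>b\<close>, say \<open>a \<le> c \<le> b\<close>; then \<open>c \<ge> a + b - 1\<close> forces \<open>a \<le> 1\<close>. So
  \<open>a * b \<le> a + b - 1 \<le> c\<close> if \<open>b \<ge> 1\<close>, and \<open>a * b \<le> a \<le> c\<close> otherwise.
\<close>

lemma region2_decreasing:
  assumes "(a, b, c) \<in> region2"
  shows "decreasing_hypergeometric a b c"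
proof
  show p: "a > 0" "b > 0" "c > 0" "c \<ge> a + b - 1" using assms by (auto simp: region2_def)
  have *: "a * b \<le> c" if "a \<le> c" "c \<le> b" "a > 0" "b > 0" "c \<ge> a + b - 1" for a b :: real
  proof (cases "b \<ge> 1")
    case True
    have "(1 - a) * (b - 1) \<ge> 0" using that True by (intro mult_nonneg_nonneg) auto
    then show ?thesis using that by (simp add: algebra_simps)
  next
    case False
    have "a * b \<le> a * 1" using that False by (intro mult_left_mono) auto
    then show ?thesis using that by linarith
  qed
  have "a \<le> c \<and> c \<le> b \<or> b \<le> c \<and> c \<le> a"
    using assms by (auto simp: region2_def mult_le_0_iff)
  then show "a * b \<le> c" using *[of a b] *[of b a] p by (auto simp: mult.commute)
qed

theorem proposition6:
  fixes a b c p q :: real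
  assumes "p > 1" and "q > 1"
  shows
   "((a, b, c) \<in> region1 \<longrightarrow>
       (\<forall>s. \<forall>n\<ge>1. s \<le> max 0 (a + b - c) \<longrightarrow>
          (\<forall>x\<in>{0<..<1}. if s = a * b / c \<and> (c = a \<or> c = b)
             then Q_fun a b c q s n x \<le> 0 else Q_fun a b c q s n x < 0)) \<and>
       (\<forall>s. \<forall>n\<ge>1. s \<ge> a * b / c \<longrightarrow>
          (\<forall>x\<in>{0<..<1}. if s = a * b / c \<and> (c = a \<or> c = b)
             then Q_fun a b c q s n x \<ge> 0 else Q_fun a b c q s n x > 0)) \<and>
       (\<forall>r\<in>{0<..<1}.
          let s0 = max 0 (a + b - c);
              G = (1 - r powr (p / q)) / (1 - r powr p);
              L = G powr (a * b / c) *
                  exp (a * b * (c - a) * (c - b) * (r powr (2 * p / q) - r powr (2 * p))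
                       / (2 * c\<^sup>2 * (c + 1)));
              M = gauss_hyp a b c (r powr p) / gauss_hyp a b c (r powr (p / q));
              U = G powr s0 *
                  exp ((s0 - a * b / c) * (r powr (p / q) - r powr p))
          in if c = a \<or> c = b then L \<le> M \<and> M \<le> U else L < M \<and> M < U))
    \<and>
    ((a, b, c) \<in> region2 \<longrightarrow>
       (\<forall>s. \<forall>n\<ge>1. s \<le> a * b / c \<longrightarrow>
          (\<forall>x\<in>{0<..<1}. if s = a * b / c \<and> (c = a \<or> c = b)
             then Q_fun a b c q s n x \<le> 0 else Q_fun a b c q s n x < 0)) \<and>
       (\<forall>s. \<forall>n\<ge>1. s \<ge> a + b - c \<longrightarrow>
          (\<forall>x\<in>{0<..<1}. if s = a * b / c \<and> (c = a \<or> c = b)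
             then Q_fun a b c q s n x \<ge> 0 else Q_fun a b c q s n x > 0)) \<and>
       (\<forall>r\<in>{0<..<1}.
          let G = (1 - r powr (p / q)) / (1 - r powr p);
              L = G powr (a + b - c) *
                  exp ((a - c) * (c - b) * (r powr (p / q) - r powr p) / c);
              M = gauss_hyp a b c (r powr p) / gauss_hyp a b c (r powr (p / q));
              U = G powr (a * b / c) *
                  exp (- (a * b * (a - c) * (c - b) * (r powr (2 * p / q) - r powr (2 * p))
                       / (2 * c\<^sup>2 * (c + 1))))
          in if c = a \<or> c = b then L \<le> M \<and> M \<le> U else L < M \<and> M < U))"
proof (intro conjI impI)
  have exps: "0 < r powr p" "r powr p < 1" "(r powr p) powr (1 / q) = r powr (p / q)"
    "r powr (2 * p) = (r powr p)\<^sup>2" "r powr (2 * p / q) = (r powr (p / q))\<^sup>2"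
    if "r \<in> {0<..<1}" for r
    using that powr_less_mono2[of p r 1] assms
    by (auto simp: powr_powr power2_eq_square simp flip: powr_add)
  {
    assume R: "(a, b, c) \<in> region1"
    interpret decreasing_hypergeometric a b c by (rule region1_decreasing[OF R])
    have D: "(c - a) * (c - b) \<ge> 0" and L: "2 * a * b \<le> (1 + a + b - a * b) * c"
      using R by (auto simp: region1_def)
    show lower: "\<forall>s. \<forall>n\<ge>1. s \<le> max 0 (a + b - c) \<longrightarrow>
        (\<forall>x\<in>{0<..<1}. if s = a * b / c \<and> (c = a \<or> c = b)
           then Q_fun a b c q s n x \<le> 0 else Q_fun a b c q s n x < 0)"
      using Q_fun_sign(1) Q_fun_degenerate_zero g_gt_max[OF D L] assms(2) by simp
    show upper: "\<forall>s. \<forall>n\<ge>1. s \<ge> a * b / c \<longrightarrow>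
        (\<forall>x\<in>{0<..<1}. if s = a * b / c \<and> (c = a \<or> c = b)
           then Q_fun a b c q s n x \<ge> 0 else Q_fun a b c q s n x > 0)"
      using Q_fun_sign(2) Q_fun_degenerate_zero g_lt_initial[OF D] assms(2) by simp
    show "\<forall>r\<in>{0<..<1}.
          let s0 = max 0 (a + b - c);
              G = (1 - r powr (p / q)) / (1 - r powr p);
              L = G powr (a * b / c) *
                  exp (a * b * (c - a) * (c - b) * (r powr (2 * p / q) - r powr (2 * p))
                       / (2 * c\<^sup>2 * (c + 1)));
              M = gauss_hyp a b c (r powr p) / gauss_hyp a b c (r powr (p / q));
              U = G powr s0 *
                  exp ((s0 - a * b / c) * (r powr (p / q) - r powr p))
          in if c = a \<or> c = b then L \<le> M \<and> M \<le> U else L < M \<and> M < U"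
      (is "\<forall>r\<in>_. ?P r")
    proof
      fix r :: real assume r: "r \<in> {0<..<1}"
      note e = exps[OF r]
      note B = hyp_ratio_bounds[OF assms(2) e(1,2), unfolded e(3), folded e(4,5)]
      have "if c = a \<or> c = b then Q_fun a b c q (max 0 (a + b - c)) 1 (r powr p) \<le> 0
          else Q_fun a b c q (max 0 (a + b - c)) 1 (r powr p) < 0"
        using lower[rule_format, OF _ order_refl, of 1 "r powr p"] e(1,2) by (auto split: if_splits)
      moreover have "if c = a \<or> c = b then Q_fun a b c q (a * b / c) 2 (r powr p) \<ge> 0
          else Q_fun a b c q (a * b / c) 2 (r powr p) > 0"
        using upper[rule_format, OF _ order_refl, of 2 "r powr p"] e(1,2) by (auto split: if_splits)
      ultimately show "?P r"
        unfolding Let_def B by presburger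
    qed
  }
  {
    assume R: "(a, b, c) \<in> region2"
    interpret decreasing_hypergeometric a b c by (rule region2_decreasing[OF R])
    have D: "(c - a) * (c - b) \<le> 0" using R by (auto simp: region2_def)
    show lower: "\<forall>s. \<forall>n\<ge>1. s \<le> a * b / c \<longrightarrow>
        (\<forall>x\<in>{0<..<1}. if s = a * b / c \<and> (c = a \<or> c = b)
           then Q_fun a b c q s n x \<le> 0 else Q_fun a b c q s n x < 0)"
      using Q_fun_sign(1) Q_fun_degenerate_zero g_gt_initial[OF D] assms(2) by simp
    show upper: "\<forall>s. \<forall>n\<ge>1. s \<ge> a + b - c \<longrightarrow>
        (\<forall>x\<in>{0<..<1}. if s = a * b / c \<and> (c = a \<or> c = b)
           then Q_fun a b c q s n x \<ge> 0 else Q_fun a b c q s n x > 0)"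
      using Q_fun_sign(2) Q_fun_degenerate_zero g_lt_limit[OF D] assms(2) by simp
    show "\<forall>r\<in>{0<..<1}.
          let G = (1 - r powr (p / q)) / (1 - r powr p);
              L = G powr (a + b - c) *
                  exp ((a - c) * (c - b) * (r powr (p / q) - r powr p) / c);
              M = gauss_hyp a b c (r powr p) / gauss_hyp a b c (r powr (p / q));
              U = G powr (a * b / c) *
                  exp (- (a * b * (a - c) * (c - b) * (r powr (2 * p / q) - r powr (2 * p))
                       / (2 * c\<^sup>2 * (c + 1))))
          in if c = a \<or> c = b then L \<le> M \<and> M \<le> U else L < M \<and> M < U"
      (is "\<forall>r\<in>_. ?P r")
    proof
      fix r :: real assume r: "r \<in> {0<..<1}"
      note e = exps[OF r]
      note B = hyp_ratio_bounds[OF assms(2) e(1,2), unfolded e(3), folded e(4,5)]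
      have "if c = a \<or> c = b then Q_fun a b c q (a * b / c) 2 (r powr p) \<le> 0
          else Q_fun a b c q (a * b / c) 2 (r powr p) < 0"
        using lower[rule_format, OF _ order_refl, of 2 "r powr p"] e(1,2) by (auto split: if_splits)
      moreover have "if c = a \<or> c = b then Q_fun a b c q (a + b - c) 1 (r powr p) \<ge> 0
          else Q_fun a b c q (a + b - c) 1 (r powr p) > 0"
        using upper[rule_format, OF _ order_refl, of 1 "r powr p"] e(1,2) by (auto split: if_splits)
      moreover have E1: "(a + b - c - a * b / c) * t = (a - c) * (c - b) * t / c" for t
        using pos by (simp add: field_simps)
      moreover have E2: "- (a * b * (a - c) * (c - b) * t / (2 * c\<^sup>2 * (c + 1)))
          = a * b * (c - a) * (c - b) * t / (2 * c\<^sup>2 * (c + 1))" for t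
        by (subst minus_divide_left) (simp add: algebra_simps)
      ultimately show "?P r"
        unfolding Let_def B E1 E2 by presburger
    qed
  }
qed

end
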